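(* Let $n\ge 2$ be an integer and let $X$ and $Y$ be real $n$-normed spaces, each of dimension at least $n$. Suppose that $f:X\to Y$ preserves $w$-$\rho$-$n$-distance for some $\rho>0$ and preserves 2-collinearity for the midpoint of a segment. Then $f$ is an affine $n$-isometry.
   Context: All linear spaces are real. An $n$-norm on a real vector space $X$ of dimension at least $n$ is a map $\|\cdot,\dots,\cdot\|:X^n\to\mathbb{R}$ such that: (a) $\|x_1,\dots,x_n\|=0$ if and only if $x_1,\dots,x_n$ are linearly dependent; (b) $\|x_1,\dots,x_n\|$ is invariant under permutation of its arguments; (c) $\|\alpha x_1,x_2,\dots,x_n\|=|\alpha|\,\|x_1,\dots,x_n\|$ for all $\alpha\in\mathbb{R}$; (d) $\|x_0+x_1,x_2,\dots,x_n\|\le\|x_0,x_2,\dots,x_n\|+\|x_1,x_2,\dots,x_n\|$. An $n$-normed space is a vector space with an $n$-norm. Let $f:X\to Y$ be a mapping between $n$-normed spaces. - $f$ preserves $w$-$\rho$-$n$-distance if for all $x_1,\dots,x_n,y\in X$, $\|x_1-y,\dots,x_n-y\|=\rho$ implies $\|f(x_1)-f(y),\dots,f(x_n)-f(y)\|=\rho$. - Points $x,y,z$ are (2-)collinear if $y-z=t(x-z)$ for some real $t$. $f$ preserves 2-collinearity for the midpoint of a segment if for all $x,y\in X$, with $z=(x+y)/2$, the points $f(x),f(y),f(z)$ are collinear. - $f$ is an $n$-isometry if $\|f(x_1)-f(y_1),\dots,f(x_n)-f(y_n)\|=\|x_1-y_1,\dots,x_n-y_n\|$ for all $x_1,\dots,x_n,y_1,\dots,y_n\in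 X$. - $f$ is affine if $x\mapsto f(x)-f(0)$ is linear over $\mathbb{R}$. *)

theory Defs
  imports Complex_Main "HOL-Library.Multiset"
begin

text \<open>An \<open>n\<close>-tuple of vectors is a list of length \<open>n\<close>; a candidate \<open>n\<close>-norm is a real-valued
  function on lists, of which only the values on lists of length \<open>n\<close> are ever used.\<close>

text \<open>Linear dependence of a tuple (a family, so a tuple with a repeated entry is dependent),
  as opposed to \<^const>\<open>dependent\<close>, which concerns the underlying set.\<close>

definition lin_dependent_tuple :: "'a::real_vector list \<Rightarrow> bool" where
  "lin_dependent_tuple xs \<longleftrightarrow>
     (\<exists>c. (\<exists>i<length xs. c i \<noteq> 0) \<and> (\<Sum>i<length xs. c i *\<^sub>R xs ! i) = 0)"

text \<open>\<^const>\<open>dim\<close> is \<open>0\<close> on infinite-dimensional spaces, so ``dimension at least \<open>n\<close>'' is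
  expressed by an independent set of \<open>n\<close> vectors.\<close>

locale n_normed_space =
  fixes n :: nat and N :: "'a::real_vector list \<Rightarrow> real"
  assumes dim_at_least: "\<exists>B::'a set. finite B \<and> card B = n \<and> independent B"
    and zero_iff: "\<And>xs. length xs = n \<Longrightarrow> N xs = 0 \<longleftrightarrow> lin_dependent_tuple xs"
    and permute: "\<And>xs ys. length xs = n \<Longrightarrow> mset ys = mset xs \<Longrightarrow> N ys = N xs"
    and scale: "\<And>a x xs. length (x # xs) = n \<Longrightarrow> N (a *\<^sub>R x # xs) = \<bar>a\<bar> * N (x # xs)"
    and triangle: "\<And>x y xs. length (x # xs) = n \<Longrightarrow> N ((x + y) # xs) \<le> N (x # xs) + N (y # xs)"

definition preserves_w_n_distance ::
  "nat \<Rightarrow> real \<Rightarrow> ('a::real_vector list \<Rightarrow> real) \<Rightarrow> ('b::real_vector list \<Rightarrow> real) \<Rightarrow> ('a \<Rightarrow> 'b) \<Rightarrow> bool"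
where
  "preserves_w_n_distance n \<rho> N M f \<longleftrightarrow>
     (\<forall>xs y. length xs = n \<longrightarrow> N (map (\<lambda>x. x - y) xs) = \<rho> \<longrightarrow> M (map (\<lambda>x. f x - f y) xs) = \<rho>)"

definition collinear2 :: "'a::real_vector \<Rightarrow> 'a \<Rightarrow> 'a \<Rightarrow> bool" where
  "collinear2 x y z \<longleftrightarrow> (\<exists>t::real. y - z = t *\<^sub>R (x - z))"

definition preserves_midpoint_collinearity :: "('a::real_vector \<Rightarrow> 'b::real_vector) \<Rightarrow> bool" where
  "preserves_midpoint_collinearity f \<longleftrightarrow> (\<forall>x y. collinear2 (f x) (f y) (f ((1/2) *\<^sub>R (x + y))))"

definition n_isometry ::
  "nat \<Rightarrow> ('a::real_vector list \<Rightarrow> real) \<Rightarrow> ('b::real_vector list \<Rightarrow> real) \<Rightarrow> ('a \<Rightarrow> 'b) \<Rightarrow> bool"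
where
  "n_isometry n N M f \<longleftrightarrow>
     (\<forall>xs ys. length xs = n \<longrightarrow> length ys = n \<longrightarrow>
        M (map2 (\<lambda>x y. f x - f y) xs ys) = N (map2 (\<lambda>x y. x - y) xs ys))"

definition affine_map :: "('a::real_vector \<Rightarrow> 'b::real_vector) \<Rightarrow> bool" where
  "affine_map f \<longleftrightarrow> linear (\<lambda>x. f x - f 0)"

end

theory Submission
  imports Defs
begin

text \<open>Any nonzero vector is the first entry of a tuple of \<open>n\<close>-norm \<open>\<rho>\<close>, so \<open>f\<close> is injective. If \<open>m\<close> is the
  midpoint of \<open>x \<noteq> y\<close>, then \<open>x - m\<close> and \<open>y - m\<close> are opposite, hence occur in tuples of norm
  \<open>\<rho>\<close> with the same remaining entries; so \<open>f y - f m = t (f x - f m)\<close> forces \<open>\<bar>t\<bar> = 1\<close>, and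
  injectivity leaves \<open>t = -1\<close>. Thus \<open>f\<close> preserves midpoints and \<open>g x = f x - f 0\<close> is additive.

  Adding multiples of \<open>x\<close> to \<open>u\<close> does not change \<open>\<parallel>x, u, \<dots>\<parallel>\<close>. Hence
  \<open>\<parallel>g x, g u + k g (s x), \<dots>\<parallel> = \<rho>\<close> for every natural \<open>k\<close>, which forces \<open>\<parallel>g x, g (s x), \<dots>\<parallel> = 0\<close>,
  and then \<open>g (s x) = \<phi> s \<cdot> g x\<close>. Applying \<open>g\<close> to the unimodular change of vectors
  \<open>(t x + (t\<^sup>2 - 1) y, x + t y)\<close> gives \<open>\<bar>\<phi> (t\<^sup>2) - 1 - (\<phi> t)\<^sup>2\<bar> = 1\<close>, so \<open>\<phi>\<close> is nonnegative on
  squares. A monotone additive function with \<open>\<phi> 1 = 1\<close> is the identity.\<close>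

section \<open>Additive maps and linearly dependent tuples\<close>

lemma additive_scaleR_of_nat:
  fixes g :: "'a::real_vector \<Rightarrow> 'b::real_vector"
  assumes "additive g"
  shows "g (of_nat k *\<^sub>R x) = of_nat k *\<^sub>R g x"
  by (induction k) (simp_all add: additive.zero[OF assms] additive.add[OF assms] scaleR_left_distrib)

lemma additive_scaleR_of_int:
  fixes g :: "'a::real_vector \<Rightarrow> 'b::real_vector"
  assumes "additive g"
  shows "g (of_int k *\<^sub>R x) = of_int k *\<^sub>R g x"
proof (cases k)
  case (nonneg m)
  then show ?thesis using additive_scaleR_of_nat[OF assms] by simp
next
  case (neg m)
  then have "of_int k = - real (Suc m)" by simp
  then show ?thesis
    using additive_scaleR_of_nat[OF assms, of "Suc m" x]
    by (simp only: scaleR_minus_left additive.minus[OF assms])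
qed

text \<open>Nonnegativity makes \<open>\<phi>\<close> monotone, and \<open>\<phi>\<close> fixes the
  integers. Hence \<open>\<phi> (m * s)\<close> lies between the same consecutive integers as
  \<open>m * s\<close>, so the error \<open>\<phi> s - s\<close> is at most 1/m in absolute value
  for every positive m.\<close>

lemma additive_nonneg_real_eq_id:
  fixes \<phi> :: "real \<Rightarrow> real"
  assumes add: "additive \<phi>" and one: "\<phi> 1 = 1" and nonneg: "\<And>s. s \<ge> 0 \<Longrightarrow> \<phi> s \<ge> 0"
  shows "\<phi> s = s"
proof -
  have mono: "\<phi> a \<le> \<phi> b" if "a \<le> b" for a b
    using nonneg[of "b - a"] that additive.diff[OF add, of b a] by simp
  have int: "\<phi> (of_int k) = of_int k" for k
    using additive_scaleR_of_int[OF add, of k 1] one by simp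
  have bound: "real m * \<bar>\<phi> s - s\<bar> \<le> 1" for m
  proof -
    define k where "k = \<lfloor>real m * s\<rfloor>"
    have le: "of_int k \<le> real m * s" "real m * s \<le> of_int (k + 1)"
      unfolding k_def by linarith+
    have "\<phi> (real m * s) = real m * \<phi> s"
      using additive_scaleR_of_nat[OF add, of m s] by simp
    then have "of_int k \<le> real m * \<phi> s" "real m * \<phi> s \<le> of_int (k + 1)"
      using mono[OF le(1)] mono[OF le(2)] int by metis+
    with le have "\<bar>real m * \<phi> s - real m * s\<bar> \<le> 1" by (auto simp: abs_le_iff)
    then show ?thesis by (simp add: abs_mult flip: right_diff_distrib)
  qed
  show ?thesis
  proof (rule ccontr)
    assume "\<phi> s \<noteq> s"
    then obtain m :: nat where "1 < real m * \<bar>\<phi> s - s\<bar>"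
      using reals_Archimedean3[of "\<bar>\<phi> s - s\<bar>"] by auto
    with bound[of m] show False by linarith
  qed
qed

text \<open>Bridge from families to sets: axiom \<open>zero_iff\<close> speaks of tuples, while
  spans, bases and \<open>representation\<close> are about sets of vectors.\<close>

lemma lin_dependent_tuple_iff:
  "lin_dependent_tuple xs \<longleftrightarrow> \<not> (distinct xs \<and> independent (set xs))"
proof (cases "distinct xs")
  case True
  then have bij: "bij_betw ((!) xs) {..<length xs} (set xs)"
    by (rule bij_betw_nth) auto
  have reindex: "(\<Sum>i<length xs. u (xs ! i) *\<^sub>R xs ! i) = (\<Sum>v\<in>set xs. u v *\<^sub>R v)" for u
    using sum.reindex_bij_betw[OF bij] .
  have "lin_dependent_tuple xs \<longleftrightarrow> dependent (set xs)"
  proof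
    assume "lin_dependent_tuple xs"
    then obtain c i where c: "i < length xs" "c i \<noteq> 0" "(\<Sum>i<length xs. c i *\<^sub>R xs ! i) = 0"
      unfolding lin_dependent_tuple_def by blast
    define u where "u v = c (the_inv_into {..<length xs} ((!) xs) v)" for v
    have u: "u (xs ! i) = c i" if "i < length xs" for i
      unfolding u_def using bij that by (simp add: bij_betw_def the_inv_into_f_f)
    have "(\<Sum>v\<in>set xs. u v *\<^sub>R v) = 0"
      using c(3) u by (simp flip: reindex)
    moreover have "u (xs ! i) \<noteq> 0" "xs ! i \<in> set xs" using c u by auto
    ultimately show "dependent (set xs)" by (auto simp: dependent_finite)
  next
    assume "dependent (set xs)"
    then obtain u v where "v \<in> set xs" "u v \<noteq> 0" "(\<Sum>v\<in>set xs. u v *\<^sub>R v) = 0"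
      by (auto simp: dependent_finite)
    then show "lin_dependent_tuple xs"
      unfolding lin_dependent_tuple_def
      by (intro exI[of _ "\<lambda>i. u (xs ! i)"]) (auto simp: reindex in_set_conv_nth)
  qed
  with True show ?thesis by simp
next
  case False
  then obtain i j where ij: "i < length xs" "j < length xs" "i \<noteq> j" "xs ! i = xs ! j"
    by (auto simp: distinct_conv_nth)
  define c :: "nat \<Rightarrow> real" where "c k = (if k = i then 1 else 0) - (if k = j then 1 else 0)" for k
  have "(\<Sum>k<length xs. c k *\<^sub>R xs ! k)
      = (\<Sum>k<length xs. (if k = i then xs ! k else 0) - (if k = j then xs ! k else 0))"
    by (intro sum.cong) (auto simp: c_def)
  also have "\<dots> = 0" using ij by (simp add: sum_subtractf)
  finally have "lin_dependent_tuple xs"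
    unfolding lin_dependent_tuple_def using ij by (intro exI[of _ c]) (auto simp: c_def)
  with False show ?thesis by simp
qed

lemma lin_dependent_tuple_map:
  assumes "linear g" "lin_dependent_tuple xs"
  shows "lin_dependent_tuple (map g xs)"
proof -
  obtain c where c: "\<exists>i<length xs. c i \<noteq> 0" "(\<Sum>i<length xs. c i *\<^sub>R xs ! i) = 0"
    using assms(2) unfolding lin_dependent_tuple_def by blast
  have "(\<Sum>i<length xs. c i *\<^sub>R map g xs ! i) = g (\<Sum>i<length xs. c i *\<^sub>R xs ! i)"
    by (simp add: linear_sum[OF assms(1)] linear_scale[OF assms(1)])
  with c show ?thesis
    unfolding lin_dependent_tuple_def by (auto simp: linear_0[OF assms(1)])
qed

section \<open>Elementary calculus of an n-norm\<close>

context n_normed_space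
begin

lemma swap:
  assumes "length (x # y # xs) = n"
  shows "N (x # y # xs) = N (y # x # xs)"
  using permute[of "y # x # xs" "x # y # xs"] assms by simp

lemma zero_arg:
  assumes "length (x # xs) = n" "0 \<in> set (x # xs)"
  shows "N (x # xs) = 0"
  using zero_iff[OF assms(1)] assms(2) dependent_zero[of "set (x # xs)"]
  by (auto simp: lin_dependent_tuple_iff)

lemma nonneg:
  assumes "length (x # xs) = n"
  shows "N (x # xs) \<ge> 0"
proof -
  have "0 = N ((x + (- 1) *\<^sub>R x) # xs)" using zero_arg[of 0 xs] assms by simp
  also have "\<dots> \<le> N (x # xs) + N ((- 1) *\<^sub>R x # xs)" using triangle[of x xs "(- 1) *\<^sub>R x"] assms by simp
  also have "\<dots> = 2 * N (x # xs)" using scale[of x xs "- 1"] assms by simp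
  finally show ?thesis by simp
qed

lemma parallel_pair:
  assumes "length (x # y # xs) = n"
  shows "N (c *\<^sub>R y # y # xs) = 0"
  using scale[of y "y # xs" c] assms zero_iff[of "y # y # xs"]
  by (simp add: lin_dependent_tuple_iff)

lemma shear:
  assumes "length (x # y # xs) = n"
  shows "N ((x + c *\<^sub>R y) # y # xs) = N (x # y # xs)"
proof (rule antisym)
  show "N ((x + c *\<^sub>R y) # y # xs) \<le> N (x # y # xs)"
    using triangle[of x "y # xs" "c *\<^sub>R y"] parallel_pair[of x y xs c] assms by simp
  show "N (x # y # xs) \<le> N ((x + c *\<^sub>R y) # y # xs)"
    using triangle[of "x + c *\<^sub>R y" "y # xs" "(- c) *\<^sub>R y"] parallel_pair[of x y xs "- c"] assms
    by simp
qed

lemma shear2: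
  assumes "length (x # y # xs) = n"
  shows "N (x # (y + c *\<^sub>R x) # xs) = N (x # y # xs)"
  using shear[of y x xs c] swap[of x "y + c *\<^sub>R x" xs] swap[of x y xs] assms by simp

lemma scale2:
  assumes "length (x # y # xs) = n"
  shows "N (x # c *\<^sub>R y # xs) = \<bar>c\<bar> * N (x # y # xs)"
  using scale[of y "x # xs" c] swap[of x "c *\<^sub>R y" xs] swap[of x y xs] assms by simp

lemma triangle2:
  assumes "length (x # y # xs) = n"
  shows "N (x # (y + z) # xs) \<le> N (x # y # xs) + N (x # z # xs)"
  using triangle[of y "x # xs" z] swap[of x "y + z" xs] swap[of x y xs] swap[of x z xs] assms
  by simp

text \<open>The factor is the absolute determinant of the coefficient matrix with rows (a, b) and
  (1, d). Subtracting \<open>a\<close> times the second vector from the first leaves a multiple of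
  \<open>y\<close>, and a shear removes \<open>d\<close>.\<close>

lemma det2:
  assumes "length (x # y # xs) = n"
  shows "N ((a *\<^sub>R x + b *\<^sub>R y) # (x + d *\<^sub>R y) # xs) = \<bar>b - a * d\<bar> * N (x # y # xs)"
proof -
  have "a *\<^sub>R x + b *\<^sub>R y = (b - a * d) *\<^sub>R y + a *\<^sub>R (x + d *\<^sub>R y)"
    by (simp add: algebra_simps)
  then have "N ((a *\<^sub>R x + b *\<^sub>R y) # (x + d *\<^sub>R y) # xs)
      = N ((b - a * d) *\<^sub>R y # (x + d *\<^sub>R y) # xs)"
    using shear assms by simp
  also have "\<dots> = \<bar>b - a * d\<bar> * N (y # (x + d *\<^sub>R y) # xs)" using scale assms by simp
  also have "N (y # (x + d *\<^sub>R y) # xs) = N (x # y # xs)"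
    using shear2[of y x xs d] swap[of x y xs] assms by simp
  finally show ?thesis .
qed

lemma zero_if_bounded_translates:
  assumes len: "length (x # u # xs) = n" and bound: "\<And>k. N (x # (u + real k *\<^sub>R v) # xs) \<le> C"
  shows "N (x # v # xs) = 0"
proof (rule ccontr)
  assume "N (x # v # xs) \<noteq> 0"
  then have "N (x # v # xs) > 0" using nonneg[of x "v # xs"] len by simp
  then obtain k where k: "2 * C < real k * N (x # v # xs)"
    using reals_Archimedean3 by blast
  have "real k * N (x # v # xs) = N (x # ((u + real k *\<^sub>R v) + (- 1) *\<^sub>R u) # xs)"
    using scale2[of x v xs "real k"] len by simp
  also have "\<dots> \<le> N (x # (u + real k *\<^sub>R v) # xs) + N (x # (- 1) *\<^sub>R u # xs)"
    using triangle2[of x "u + real k *\<^sub>R v" xs "(- 1) *\<^sub>R u"] len by simp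
  \<comment> \<open>The term in \<open>u\<close> alone is the translate with index 0, so the same
    bound covers it.\<close>
  also have "N (x # (- 1) *\<^sub>R u # xs) = N (x # (u + real 0 *\<^sub>R v) # xs)"
    using scale2[of x u xs "- 1"] len by simp
  also have "N (x # (u + real k *\<^sub>R v) # xs) + \<dots> \<le> C + C"
    using bound by (intro add_mono)
  finally show False using k by simp
qed

text \<open>Extend \<open>x\<close> to a basis of the span of \<open>insert x B\<close>. By the
  exchange bound it has at least \<open>n\<close> elements, so \<open>n - 1\<close> of them can
  accompany \<open>x\<close>.\<close>

lemma extend_nonzero:
  assumes "x \<noteq> 0" "n \<ge> 1"
  obtains xs where "length (x # xs) = n" "N (x # xs) \<noteq> 0"
proof -
  obtain B :: "'a set" where B: "finite B" "card B = n" "independent B"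
    using dim_at_least by blast
  obtain C where C: "{x} \<subseteq> C" "C \<subseteq> insert x B" "independent C" "insert x B \<subseteq> span C"
    using maximal_independent_subset_extend[of "{x}" "insert x B"] assms(1) by auto
  have fin: "finite C" using C(2) B(1) finite_subset by blast
  have "n \<le> card C"
    using independent_span_bound[OF fin B(3)] C(4) B(2) by auto
  then have "n - 1 \<le> card (C - {x})" using C(1) fin by (simp add: card_Diff_singleton)
  then obtain D where D: "D \<subseteq> C - {x}" "card D = n - 1" "finite D"
    using obtain_subset_with_card_n by metis
  obtain xs where xs: "set xs = D" "distinct xs"
    using finite_distinct_list[OF D(3)] by blast
  have len: "length (x # xs) = n"
    using xs D(2) distinct_card[OF xs(2)] assms(2) by simp
  have "set (x # xs) \<subseteq> C" "distinct (x # xs)" using C(1) D(1) xs by auto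
  then have "independent (set (x # xs))" "distinct (x # xs)"
    using independent_mono[OF C(3)] by blast+
  then have "N (x # xs) \<noteq> 0" using zero_iff[OF len] by (simp add: lin_dependent_tuple_iff)
  with len that show ?thesis by blast
qed

text \<open>The second entry is rescaled, not the first, so that \<open>x\<close> itself stays in
  the tuple.\<close>

lemma extend_to_norm:
  assumes "x \<noteq> 0" "n \<ge> 2" "\<rho> > 0"
  obtains y xs where "length (x # y # xs) = n" "N (x # y # xs) = \<rho>"
proof -
  obtain zs where zs: "length (x # zs) = n" "N (x # zs) \<noteq> 0"
    using extend_nonzero[of x] assms by auto
  then obtain z xs where z: "zs = z # xs" using assms(2) by (cases zs) auto
  let ?c = "\<rho> / N (x # z # xs)"
  have pos: "N (x # z # xs) > 0" using nonneg[of x zs] zs z by simp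
  then have "N (x # ?c *\<^sub>R z # xs) = \<rho>"
    using scale2[of x z xs ?c] zs(1) z assms(3) by simp
  then show ?thesis using that[of "?c *\<^sub>R z" xs] zs(1) z by simp
qed

end

section \<open>Additive maps preserving the value \<open>\<rho>\<close> are linear and preserve the
  n-norm\<close>

locale additive_w_preserving =
  X: n_normed_space n NX + Y: n_normed_space n NY + additive g
  for n :: nat and NX :: "'a::real_vector list \<Rightarrow> real"
    and NY :: "'b::real_vector list \<Rightarrow> real" and g :: "'a \<Rightarrow> 'b" +
  fixes \<rho> :: real
  assumes n_ge_2: "n \<ge> 2" and \<rho>_pos: "\<rho> > 0"
    and preserves: "\<And>xs. length xs = n \<Longrightarrow> NX xs = \<rho> \<Longrightarrow> NY (map g xs) = \<rho>"
begin

lemma image_nonzero: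
  assumes "x \<noteq> 0"
  shows "g x \<noteq> 0"
proof
  assume "g x = 0"
  obtain y xs where "length (x # y # xs) = n" "NX (x # y # xs) = \<rho>"
    using X.extend_to_norm[OF assms n_ge_2 \<rho>_pos] .
  then show False
    using preserves[of "x # y # xs"] Y.zero_arg[of "g x" "map g (y # xs)"] \<open>g x = 0\<close> \<rho>_pos by auto
qed

lemma image_multiple_norm_zero:
  assumes "length (x # u # ws) = n" "NX (x # u # ws) = \<rho>"
  shows "NY (g x # g (s *\<^sub>R x) # map g ws) = 0"
proof (rule Y.zero_if_bounded_translates)
  show "length (g x # g u # map g ws) = n" using assms by simp
  fix k
  have "NX (x # (u + (real k * s) *\<^sub>R x) # ws) = \<rho>"
    using X.shear2[OF assms(1)] assms(2) by simp
  then have "NY (map g (x # (u + (real k * s) *\<^sub>R x) # ws)) = \<rho>"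
    using preserves[of "x # (u + (real k * s) *\<^sub>R x) # ws"] assms(1) by simp
  moreover have "g ((real k * s) *\<^sub>R x) = real k *\<^sub>R g (s *\<^sub>R x)"
    using additive_scaleR_of_nat[OF additive_axioms, of k "s *\<^sub>R x"] by simp
  ultimately show "NY (g x # (g u + real k *\<^sub>R g (s *\<^sub>R x)) # map g ws) \<le> \<rho>"
    by (simp add: add)
qed

text \<open>Any companion \<open>u\<close> of \<open>x\<close> can play the role of the second entry
  in \<open>image_multiple_norm_zero\<close>. So \<open>g (s *\<^sub>R x)\<close> lies in the span
  of \<open>B\<close> without \<open>g u\<close>, for each \<open>u\<close> in \<open>us\<close>;
  its coordinates along all of these \<open>g u\<close> vanish, leaving only
  \<open>g x\<close>.\<close>

lemma image_multiple:
  obtains r where "g (s *\<^sub>R x) = r *\<^sub>R g x"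
proof (cases "x = 0")
  case True
  then show ?thesis using that[of 0] zero by simp
next
  case False
  obtain y zs where yz: "length (x # y # zs) = n" "NX (x # y # zs) = \<rho>"
    using X.extend_to_norm[OF False n_ge_2 \<rho>_pos] .
  define us where "us = y # zs"
  have us: "length (x # us) = n" "NX (x # us) = \<rho>" using yz by (simp_all add: us_def)
  define B where "B = set (map g (x # us))"
  have "NY (map g (x # us)) \<noteq> 0" using preserves[OF us] \<rho>_pos by simp
  then have dist: "distinct (map g (x # us))" and ind: "independent B"
    using Y.zero_iff[of "map g (x # us)"] us(1) by (auto simp: lin_dependent_tuple_iff B_def)
  let ?v = "g (s *\<^sub>R x)"
  have span: "?v \<in> span (B - {g u})" if u: "u \<in> set us" for u
  proof -
    let ?ws = "remove1 u us"
    have "mset (x # u # ?ws) = mset (x # us)" using u by simp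
    then have "NX (x # u # ?ws) = \<rho>" "length (x # u # ?ws) = n"
      using X.permute[OF us(1)] us mset_eq_length by metis+
    then have len: "length (g x # ?v # map g ?ws) = n"
      and "NY (g x # ?v # map g ?ws) = 0"
      using image_multiple_norm_zero by auto
    then have dep: "\<not> (distinct (g x # ?v # map g ?ws) \<and> independent (set (g x # ?v # map g ?ws)))"
      using Y.zero_iff[OF len] lin_dependent_tuple_iff by blast
    have "distinct us" using dist by (simp add: distinct_map)
    then have ws: "set ?ws = set us - {u}" by simp
    have S: "set (map g (x # ?ws)) = B - {g u}"
      using dist u by (auto simp: ws B_def dest: inj_onD simp: distinct_map)
    have "independent (B - {g u})" using ind by (rule independent_mono) auto
    moreover have "distinct (map g (x # ?ws))"
      using dist by (auto simp: distinct_map ws inj_on_def)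
    ultimately show ?thesis
    proof (cases "?v \<in> B - {g u}")
      case False
      then have "?v \<noteq> g x" "?v \<notin> set (map g ?ws)" using S by auto
      with dep \<open>distinct (map g (x # ?ws))\<close>
      have "dependent (set (g x # ?v # map g ?ws))" by auto
      moreover have "set (g x # ?v # map g ?ws) = insert ?v (B - {g u})"
        unfolding S[symmetric] by auto
      ultimately show ?thesis
        using \<open>independent (B - {g u})\<close> independent_insertI by metis
    qed (rule span_base)
  qed
  have "?v \<in> span B"
    \<comment> \<open>Since \<open>n \<ge> 2\<close>, the list \<open>us\<close> has a member
      \<open>y\<close> for which \<open>span\<close> can be invoked.\<close>
    using span[of y] span_mono[of "B - {g y}" B] by (auto simp: us_def)
  have zero: "representation B ?v b = 0" if b: "b \<in> B" "b \<noteq> g x" for b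
  proof -
    obtain u where "u \<in> set us" "b = g u" using b by (auto simp: B_def)
    \<comment> \<open>Coordinates in \<open>B\<close> agree with those in the smaller independent
      set whose span contains the vector, and these vanish at \<open>b\<close>.\<close>
    then have "representation B ?v = representation (B - {b}) ?v"
      using representation_extend[OF ind span[of u]] by auto
    then show ?thesis using representation_ne_zero[of "B - {b}" ?v b] by auto
  qed
  have "?v = (\<Sum>b\<in>B. representation B ?v b *\<^sub>R b)"
    using sum_representation_eq[OF ind \<open>?v \<in> span B\<close>, of B] by (simp add: B_def)
  also have "\<dots> = (\<Sum>b\<in>{g x}. representation B ?v b *\<^sub>R b)"
    by (rule sum.mono_neutral_right) (use zero in \<open>auto simp: B_def\<close>)
  finally show ?thesis using that by simp
qed

lemma homogeneous: "g (s *\<^sub>R x) = s *\<^sub>R g x"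
proof (cases "x = 0")
  case True
  then show ?thesis using zero by simp
next
  case False
  have "\<forall>x s. \<exists>r. g (s *\<^sub>R x) = r *\<^sub>R g x" by (meson image_multiple)
  then obtain \<phi> where \<phi>: "\<And>x s. g (s *\<^sub>R x) = \<phi> x s *\<^sub>R g x" by metis
  obtain y xs where len: "length (x # y # xs) = n" and N: "NX (x # y # xs) = \<rho>"
    using X.extend_to_norm[OF False n_ge_2 \<rho>_pos] .
  have gx: "g x \<noteq> 0" using image_nonzero[OF False] .
  have len': "length (g x # g y # map g xs) = n" using len by simp
  have M: "NY (g x # g y # map g xs) = \<rho>" using preserves[OF len N] by simp
  \<comment> \<open>The factor could a priori depend on the vector. The image of
    \<open>s *\<^sub>R (x + y)\<close> is parallel to that of \<open>x + y\<close>, so the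
    determinant of their coefficients in \<open>g x\<close>, \<open>g y\<close> is zero.\<close>
  have same: "\<phi> x s = \<phi> y s" for s
  proof -
    have "NY (g (s *\<^sub>R (x + y)) # g (x + y) # map g xs) = 0"
      using Y.parallel_pair[of "g x" "g (x + y)" "map g xs" "\<phi> (x + y) s"] len \<phi>[of s "x + y"]
      by simp
    moreover have "g (s *\<^sub>R (x + y)) = \<phi> x s *\<^sub>R g x + \<phi> y s *\<^sub>R g y"
      by (simp add: scaleR_right_distrib add \<phi>)
    ultimately have "\<bar>\<phi> y s - \<phi> x s\<bar> * \<rho> = 0"
      using Y.det2[OF len', of "\<phi> x s" "\<phi> y s" 1] M by (simp add: add)
    then show ?thesis using \<rho>_pos by simp
  qed
  have "additive (\<phi> x)"
  proof
    fix s t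
    have "\<phi> x (s + t) *\<^sub>R g x = (\<phi> x s + \<phi> x t) *\<^sub>R g x"
      using \<phi>[of "s + t" x] by (simp add: scaleR_left_distrib add \<phi>)
    then show "\<phi> x (s + t) = \<phi> x s + \<phi> x t" using gx by simp
  qed
  moreover have one: "\<phi> x 1 = 1" using \<phi>[where s = 1 and x = x] gx scaleR_cancel_right[of "\<phi> x 1" "g x" 1] by simp
  moreover have "\<phi> x s \<ge> 0" if "s \<ge> 0" for s
  proof -
    define t where "t = sqrt s"
    have t: "t * t = s" using that by (simp add: t_def)
    \<comment> \<open>The entry \<open>s - 1\<close> makes the determinant factor
      \<open>\<bar>s - 1 - t * t\<bar>\<close> equal to 1.\<close>
    have "NX ((t *\<^sub>R x + (s - 1) *\<^sub>R y) # (x + t *\<^sub>R y) # xs) = \<rho>"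
      using X.det2[OF len, of t "s - 1" t] N t by simp
    then have "NY (g (t *\<^sub>R x + (s - 1) *\<^sub>R y) # g (x + t *\<^sub>R y) # map g xs) = \<rho>"
      using preserves[of "(t *\<^sub>R x + (s - 1) *\<^sub>R y) # (x + t *\<^sub>R y) # xs"] len by simp
    moreover have "\<phi> y (s - 1) = \<phi> x s - 1"
      using additive.diff[OF \<open>additive (\<phi> x)\<close>] one same by simp
    ultimately have "\<bar>(\<phi> x s - 1) - \<phi> x t * \<phi> x t\<bar> * \<rho> = \<rho>"
      using Y.det2[OF len', of "\<phi> x t" "\<phi> x s - 1" "\<phi> x t"] M
      by (simp add: add \<phi> same[symmetric])
    then have "\<bar>(\<phi> x s - 1) - \<phi> x t * \<phi> x t\<bar> = 1" using \<rho>_pos by simp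
    \<comment> \<open>Either \<open>\<phi> x s\<close> is the square of \<open>\<phi> x t\<close>,
      or it exceeds that square by 2.\<close>
    then show ?thesis using zero_le_square[of "\<phi> x t"] by linarith
  qed
  ultimately have "\<phi> x s = s" by (rule additive_nonneg_real_eq_id)
  then show ?thesis using \<phi> by simp
qed

lemma linear: "linear g"
  by (rule linearI) (simp_all add: add homogeneous)

text \<open>A nonzero value is brought to \<open>\<rho>\<close> by rescaling the first entry, which
  \<open>g\<close> respects by homogeneity; the value 0 means dependence, which linear maps
  preserve.\<close>

lemma norm_preserving:
  assumes "length xs = n"
  shows "NY (map g xs) = NX xs"
proof (cases "NX xs = 0")
  case True
  then show ?thesis
    using lin_dependent_tuple_map[OF linear] X.zero_iff Y.zero_iff assms
    by (metis length_map)
next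
  case False
  obtain y ys where xs: "xs = y # ys" using assms n_ge_2 by (cases xs) auto
  have pos: "NX (y # ys) > 0" using False X.nonneg[of y ys] assms xs by simp
  let ?c = "\<rho> / NX (y # ys)"
  have c: "?c > 0" using pos \<rho>_pos by simp
  have "NX (?c *\<^sub>R y # ys) = \<rho>" using X.scale[of y ys ?c] assms xs pos c \<rho>_pos by simp
  then have "NY (?c *\<^sub>R g y # map g ys) = \<rho>"
    using preserves[of "?c *\<^sub>R y # ys"] assms xs by (simp add: homogeneous)
  then have "?c * NY (g y # map g ys) = \<rho>"
    using Y.scale[of "g y" "map g ys" ?c] assms xs pos \<rho>_pos by simp
  then show ?thesis using pos \<rho>_pos xs by (simp add: field_simps)
qed

end

section \<open>From midpoints to additivity, and the conclusion\<close>

lemma preserves_midpoint: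
  assumes n: "n \<ge> 2" and NX: "n_normed_space n NX" and NY: "n_normed_space n NY"
    and \<rho>: "\<rho> > 0"
    and dist: "preserves_w_n_distance n \<rho> NX NY f"
    and mid: "preserves_midpoint_collinearity f"
  shows "f ((1/2) *\<^sub>R (x + y)) = (1/2) *\<^sub>R (f x + f y)"
proof (cases "x = y")
  case True
  then show ?thesis by (simp flip: scaleR_2)
next
  case False
  interpret X: n_normed_space n NX by fact
  interpret Y: n_normed_space n NY by fact
  \<comment> \<open>The distance hypothesis restated for difference vectors \<open>us\<close> at an
    arbitrary base point \<open>a\<close>.\<close>
  have pres: "NY (map (\<lambda>u. f (u + a) - f a) us) = \<rho>" if "length us = n" "NX us = \<rho>" for us a
  proof -
    have "map (\<lambda>x. x - a) (map (\<lambda>u. u + a) us) = us" by (simp add: comp_def)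
    then have "NY (map (\<lambda>x. f x - f a) (map (\<lambda>u. u + a) us)) = \<rho>"
      using dist that unfolding preserves_w_n_distance_def by (metis length_map)
    then show ?thesis by (simp add: comp_def)
  qed
  have inj: "f x \<noteq> f y"
  proof
    assume eq: "f x = f y"
    obtain u us where u: "length ((x - y) # u # us) = n" "NX ((x - y) # u # us) = \<rho>"
      using X.extend_to_norm[of "x - y"] False n \<rho> by auto
    show False
      using pres[OF u, of y] eq \<rho> u(1)
        Y.zero_arg[of 0 "map (\<lambda>u. f (u + y) - f y) (u # us)"] by simp
  qed
  define m where "m = (1/2) *\<^sub>R (x + y)"
  define h where "h = x - m"
  have y: "y - m = (- 1) *\<^sub>R h"
  proof -
    have "h + (y - m) = 2 *\<^sub>R (x + y - 2 *\<^sub>R m) - (x + y - 2 *\<^sub>R m)"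
      by (simp add: h_def algebra_simps scaleR_2)
    also have "x + y - 2 *\<^sub>R m = 0" by (simp add: m_def)
    finally show ?thesis by (simp add: eq_neg_iff_add_eq_0 add.commute)
  qed
  have "h \<noteq> 0" using False y by (auto simp: h_def)
  then obtain u us where u: "length (h # u # us) = n" "NX (h # u # us) = \<rho>"
    using X.extend_to_norm[of h] n \<rho> by auto
  let ?W = "map (\<lambda>u. f (u + m) - f m) (u # us)"
  have "NY ((f x - f m) # ?W) = \<rho>" using pres[OF u, of m] by (simp add: h_def)
  moreover have "NX ((y - m) # u # us) = \<rho>"
    using X.scale[of h "u # us" "- 1"] u y by simp
  then have "NY ((f y - f m) # ?W) = \<rho>" using pres[of "(y - m) # u # us" m] u(1) by simp
  moreover obtain t where t: "f y - f m = t *\<^sub>R (f x - f m)"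
    using mid unfolding preserves_midpoint_collinearity_def collinear2_def m_def by blast
  ultimately have "\<bar>t\<bar> * \<rho> = \<rho>"
    using Y.scale[of "f x - f m" ?W t] u(1) by simp
  then have "t = 1 \<or> t = - 1" using \<rho> by auto
  \<comment> \<open>The case \<open>t = 1\<close> would give \<open>f x = f y\<close>.\<close>
  then have "f y - f m = - (f x - f m)" using t inj by auto
  then have "f x + f y = 2 *\<^sub>R f m" by (simp add: scaleR_2 algebra_simps)
  then show ?thesis by (simp add: m_def)
qed

lemma additive_if_preserves_midpoints:
  fixes f :: "'a::real_vector \<Rightarrow> 'b::real_vector"
  assumes "\<And>x y. f ((1/2) *\<^sub>R (x + y)) = (1/2) *\<^sub>R (f x + f y)"
  shows "additive (\<lambda>x. f x - f 0)"
proof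
  fix x y
  have double: "f (2 *\<^sub>R z) + f 0 = 2 *\<^sub>R f z" for z
    using assms[of "2 *\<^sub>R z" 0] by simp
  have "f (x + y) + f 0 = 2 *\<^sub>R f ((1/2) *\<^sub>R (x + y))"
    using double[of "(1/2) *\<^sub>R (x + y)"] by simp
  also have "\<dots> = f x + f y" by (simp add: assms)
  finally show "f (x + y) - f 0 = (f x - f 0) + (f y - f 0)" by (simp add: algebra_simps)
qed

theorem proposition2p4:
  fixes n :: nat and \<rho> :: real
    and NX :: "'a::real_vector list \<Rightarrow> real"
    and NY :: "'b::real_vector list \<Rightarrow> real"
    and f :: "'a \<Rightarrow> 'b"
  assumes "n \<ge> 2"
    and "n_normed_space n NX"
    and "n_normed_space n NY"
    and "\<rho> > 0"
    and "preserves_w_n_distance n \<rho> NX NY f"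
    and "preserves_midpoint_collinearity f"
  shows "affine_map f \<and> n_isometry n NX NY f"
proof -
  define g where "g x = f x - f 0" for x
  have "additive g"
    using additive_if_preserves_midpoints[OF preserves_midpoint[OF assms]]
    by (simp add: g_def[abs_def])
  moreover have "NY (map g xs) = \<rho>" if "length xs = n" "NX xs = \<rho>" for xs
    using assms(5) that unfolding preserves_w_n_distance_def g_def[abs_def]
    by (auto dest!: spec[of _ xs] spec[of _ 0])
  ultimately interpret additive_w_preserving n NX NY g \<rho>
    using assms by (simp add: additive_w_preserving_def additive_w_preserving_axioms_def)
  have "NY (map2 (\<lambda>x y. f x - f y) xs ys) = NX (map2 (\<lambda>x y. x - y) xs ys)"
    if "length xs = n" "length ys = n" for xs ys
  proof -
    \<comment> \<open>By additivity \<open>g (x - y) = g x - g y\<close>, where the two copies of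
      \<open>f 0\<close> cancel.\<close>
    have "map2 (\<lambda>x y. f x - f y) xs ys = map g (map2 (\<lambda>x y. x - y) xs ys)"
      by (auto simp: diff) (simp add: g_def)
    then show ?thesis using norm_preserving[of "map2 (\<lambda>x y. x - y) xs ys"] that
      by (simp del: map_map)
  qed
  moreover have "affine_map f" using linear by (simp add: affine_map_def g_def[abs_def])
  ultimately show ?thesis by (simp add: n_isometry_def)
qed

end
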